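(* Let $(X,d)$ be a metric space satisfying Busemann's axiom. The following four conditions are equivalent: (1) $(X,d)$ is compact; (2) $(X,d_{\mathrm{arith}})$ is compact; (3) $(X,d_{\max})$ is compact; (4) every sequence in $X$ has a convergent subsequence with respect to the metric $d$.
   Context: A metric on a non-empty set $X$ is a function $d:X\times X\to[0,\infty)$ with $d(x,y)=0$ iff $x=y$, and $d(x,z)\le d(x,y)+d(y,z)$ for all $x,y,z$; symmetry is NOT assumed. $(X,d)$ satisfies Busemann's axiom if for every $x\in X$ and every sequence $(x_n)$ in $X$: $d(x_n,x)\to0$ if and only if $d(x,x_n)\to0$. Under this axiom, $x_n\to x$ with respect to $d$ means $d(x_n,x)\to0$ (equivalently $d(x,x_n)\to0$), and the topology $\mathcal T_d$ of $(X,d)$ is the one in which $U$ is open iff for every $x\in U$ and every sequence $x_n\to x$, $x_n$ lies in $U$ for all sufficiently large $n$. $(X,d)$ is called compact if it is compact for $\mathcal T_d$. Symmetrisations: $d_{\mathrm{arith}}(x,y)=\frac12(d(x,y)+d(y,x))$, $d_{\max}(x,y)=\max\{d(x,y),d(y,x)\}$, which are symmetric metrics. *)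

theory Defs
  imports "HOL-Analysis.Analysis"
begin

text \<open>
  Metrics are not assumed to be symmetric, so the locale \<^locale>\<open>Metric_space\<close> does not apply.
  All axioms are relativised to the carrier; \<open>d\<close> is arbitrary outside of it.
\<close>

locale asym_metric_space =
  fixes X :: "'a set" and d :: "'a \<Rightarrow> 'a \<Rightarrow> real"
  assumes nonempty: "X \<noteq> {}"
    and nonneg: "\<lbrakk>x \<in> X; y \<in> X\<rbrakk> \<Longrightarrow> 0 \<le> d x y"
    and zero_iff: "\<lbrakk>x \<in> X; y \<in> X\<rbrakk> \<Longrightarrow> d x y = 0 \<longleftrightarrow> x = y"
    and triangle: "\<lbrakk>x \<in> X; y \<in> X; z \<in> X\<rbrakk> \<Longrightarrow> d x z \<le> d x y + d y z"

definition busemann_axiom :: "'a set \<Rightarrow> ('a \<Rightarrow> 'a \<Rightarrow> real) \<Rightarrow> bool" where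
  "busemann_axiom X d \<longleftrightarrow>
     (\<forall>x\<in>X. \<forall>s. range s \<subseteq> X \<longrightarrow>
        ((\<lambda>n::nat. d (s n) x) \<longlonglongrightarrow> 0) = ((\<lambda>n. d x (s n)) \<longlonglongrightarrow> 0))"

text \<open>Only used for sequences and limits in the carrier.\<close>

definition d_converges :: "('a \<Rightarrow> 'a \<Rightarrow> real) \<Rightarrow> (nat \<Rightarrow> 'a) \<Rightarrow> 'a \<Rightarrow> bool" where
  "d_converges d s x \<longleftrightarrow> (\<lambda>n. d (s n) x) \<longlonglongrightarrow> 0"

definition d_open :: "'a set \<Rightarrow> ('a \<Rightarrow> 'a \<Rightarrow> real) \<Rightarrow> 'a set \<Rightarrow> bool" where
  "d_open X d U \<longleftrightarrow> U \<subseteq> X \<and>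
     (\<forall>x\<in>U. \<forall>s. range s \<subseteq> X \<and> d_converges d s x \<longrightarrow> (\<forall>\<^sub>F n in sequentially. s n \<in> U))"

definition d_topology :: "'a set \<Rightarrow> ('a \<Rightarrow> 'a \<Rightarrow> real) \<Rightarrow> 'a topology" where
  "d_topology X d = topology (d_open X d)"

definition d_compact :: "'a set \<Rightarrow> ('a \<Rightarrow> 'a \<Rightarrow> real) \<Rightarrow> bool" where
  "d_compact X d \<longleftrightarrow> compact_space (d_topology X d)"

definition d_arith :: "('a \<Rightarrow> 'a \<Rightarrow> real) \<Rightarrow> 'a \<Rightarrow> 'a \<Rightarrow> real" where
  "d_arith d x y = (d x y + d y x) / 2"

definition d_max :: "('a \<Rightarrow> 'a \<Rightarrow> real) \<Rightarrow> 'a \<Rightarrow> 'a \<Rightarrow> real" where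
  "d_max d x y = max (d x y) (d y x)"

lemma istopology_d_open: "istopology (d_open X d)"
  unfolding istopology_def
proof (intro conjI allI impI)
  fix S T assume "d_open X d S" "d_open X d T"
  then show "d_open X d (S \<inter> T)"
    by (auto simp: d_open_def eventually_conj_iff)
next
  fix K assume K: "\<forall>S\<in>K. d_open X d S"
  show "d_open X d (\<Union>K)"
    unfolding d_open_def
  proof (intro conjI ballI allI impI)
    show "\<Union>K \<subseteq> X" using K by (auto simp: d_open_def)
  next
    fix x s assume x: "x \<in> \<Union>K" and s: "range s \<subseteq> X \<and> d_converges d s x"
    then obtain S where "S \<in> K" "x \<in> S" by blast
    with K s have "\<forall>\<^sub>F n in sequentially. s n \<in> S" by (auto simp: d_open_def)
    then show "\<forall>\<^sub>F n in sequentially. s n \<in> \<Union>K"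
      by (rule eventually_mono) (use \<open>S \<in> K\<close> in blast)
  qed
qed

lemma openin_d_topology: "openin (d_topology X d) U \<longleftrightarrow> d_open X d U"
  by (simp add: d_topology_def istopology_d_open)

lemma topspace_d_topology [simp]: "topspace (d_topology X d) = X"
proof -
  have "d_open X d X" by (auto simp: d_open_def intro!: always_eventually)
  then show ?thesis
    unfolding topspace_def openin_d_topology by (auto simp: d_open_def)
qed

text \<open>For symmetric metrics the topology is the library's metric topology.\<close>

lemma (in Metric_space) d_topology_eq_mtopology: "d_topology M d = mtopology"
  unfolding topology_eq openin_d_topology
proof (intro allI iffI)
  fix U assume U: "openin mtopology U"
  show "d_open M d U"
    unfolding d_open_def
  proof (intro conjI ballI allI impI)
    show "U \<subseteq> M" using U openin_mtopology by blast
  next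
    fix x s assume x: "x \<in> U" and s: "range s \<subseteq> M \<and> d_converges d s x"
    from U x have "x \<in> M" using openin_mtopology by blast
    with s have "limitin mtopology s x sequentially"
      by (auto simp: limitin_metric_dist_null d_converges_def intro!: always_eventually)
    with U x show "\<forall>\<^sub>F n in sequentially. s n \<in> U"
      by (simp add: limitin_def)
  qed
next
  fix U assume U: "d_open M d U"
  show "openin mtopology U"
    unfolding openin_mtopology
  proof (intro conjI allI impI)
    show "U \<subseteq> M" using U by (simp add: d_open_def)
  next
    fix x assume x: "x \<in> U"
    show "\<exists>r>0. mball x r \<subseteq> U"
    proof (rule ccontr)
      assume "\<not> ?thesis"
      then have "\<forall>n::nat. \<exists>y. y \<in> mball x (inverse (real (Suc n))) \<and> y \<notin> U"
        by (metis inverse_positive_iff_positive of_nat_0_less_iff subsetI zero_less_Suc)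
      then obtain s where s: "\<And>n. s n \<in> mball x (inverse (real (Suc n)))" "\<And>n. s n \<notin> U"
        by metis
      have "(\<lambda>n. d (s n) x) \<longlonglongrightarrow> 0"
      proof (rule tendsto_sandwich[OF _ _ tendsto_const LIMSEQ_inverse_real_of_nat])
        show "\<forall>\<^sub>F n in sequentially. 0 \<le> d (s n) x" by simp
        show "\<forall>\<^sub>F n in sequentially. d (s n) x \<le> inverse (real (Suc n))"
          using s(1) by (intro always_eventually) (simp add: commute less_imp_le)
      qed
      moreover have "range s \<subseteq> M" using s(1) by auto
      ultimately have "\<forall>\<^sub>F n in sequentially. s n \<in> U"
        using U x by (auto simp: d_open_def d_converges_def)
      with s(2) show False by simp
    qed
  qed
qed

end

theory Submission
  imports Defs
begin

text \<open>
  Under Busemann's axiom a sequence that converges in one variable of \<open>d\<close> converges in the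
  other one too, so \<open>d\<close>, \<open>d_arith d\<close> and \<open>d_max d\<close> have the same convergent sequences, with the
  same limits. Each of the three topologies is determined by its convergent sequences, hence they
  coincide (\<open>busemann_topology_eq\<close>), and the first three conditions say the same thing.

  As \<open>d_max d\<close> is symmetric, this common topology is an ordinary metric topology, in which
  compactness is the same as sequential compactness. Its convergent sequences being those of \<open>d\<close>,
  this gives the fourth condition (\<open>busemann_compact_iff_sequentially\<close>).
\<close>

lemma d_topology_cong:
  assumes "\<And>s x. range s \<subseteq> X \<Longrightarrow> x \<in> X \<Longrightarrow> d_converges d s x \<longleftrightarrow> d_converges d' s x"
  shows "d_topology X d = d_topology X d'"
proof -
  have "d_open X d U \<longleftrightarrow> d_open X d' U" for U
    using assms unfolding d_open_def by (meson subsetD)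
  then show ?thesis
    by (simp add: topology_eq openin_d_topology)
qed

context asym_metric_space
begin

text \<open>
  Any function that is squeezed between \<open>d\<close> and the sum of \<open>d\<close> and its reverse, up to a factor 2,
  has the convergent sequences of \<open>d\<close>: by Busemann's axiom both summands tend to 0 along them.
  Both symmetrisations are of this kind. The bounds are demanded only inside the carrier, so that
  values elsewhere may be modified freely.
\<close>

lemma busemann_d_converges_iff:
  assumes B: "busemann_axiom X d"
    and lower: "\<And>x y. x \<in> X \<Longrightarrow> y \<in> X \<Longrightarrow> d x y \<le> 2 * e x y"
    and upper: "\<And>x y. x \<in> X \<Longrightarrow> y \<in> X \<Longrightarrow> e x y \<le> d x y + d y x"
    and s: "range s \<subseteq> X" and x: "x \<in> X"
  shows "d_converges e s x \<longleftrightarrow> d_converges d s x"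
proof
  have sX: "s n \<in> X" for n
    using s by auto
  assume "d_converges e s x"
  then have "(\<lambda>n. 2 * e (s n) x) \<longlonglongrightarrow> 0"
    unfolding d_converges_def by (rule tendsto_mult_right_zero)
  then show "d_converges d s x"
    unfolding d_converges_def
    by (rule tendsto_sandwich[rotated 3, where f = "\<lambda>_. 0"])
       (use sX x nonneg lower in auto)
next
  have sX: "s n \<in> X" for n
    using s by auto
  have e0: "0 \<le> e (s n) x" for n
    using lower[OF sX x] nonneg[OF sX x] by (meson order_trans zero_le_mult_iff
      zero_less_numeral not_less)
  assume conv: "d_converges d s x"
  then have "(\<lambda>n. d x (s n)) \<longlonglongrightarrow> 0"
    using B s x by (auto simp: busemann_axiom_def d_converges_def)
  with conv have "(\<lambda>n. d (s n) x + d x (s n)) \<longlonglongrightarrow> 0"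
    unfolding d_converges_def by (rule tendsto_add_zero)
  then show "d_converges e s x"
    unfolding d_converges_def
    by (rule tendsto_sandwich[rotated 3, where f = "\<lambda>_. 0"])
       (use sX x e0 upper in auto)
qed

lemma busemann_topology_eq:
  assumes "busemann_axiom X d"
    and "\<And>x y. x \<in> X \<Longrightarrow> y \<in> X \<Longrightarrow> d x y \<le> 2 * e x y"
    and "\<And>x y. x \<in> X \<Longrightarrow> y \<in> X \<Longrightarrow> e x y \<le> d x y + d y x"
  shows "d_topology X e = d_topology X d"
  by (intro d_topology_cong busemann_d_converges_iff assms)

text \<open>
  The locale for symmetric metrics demands nonnegativity at all points of the type, whereas
  \<open>d\<close> may be negative outside of \<open>X\<close>; the absolute value repairs this and changes nothing on \<open>X\<close>.
\<close>

lemma Metric_space_abs_d_max: "Metric_space X (\<lambda>x y. \<bar>d_max d x y\<bar>)"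
proof
  fix x y
  show "\<bar>d_max d x y\<bar> = \<bar>d_max d y x\<bar>"
    by (simp add: d_max_def max.commute)
next
  fix x y assume "x \<in> X" "y \<in> X"
  then show "\<bar>d_max d x y\<bar> = 0 \<longleftrightarrow> x = y"
    using nonneg[of x y] nonneg[of y x] zero_iff[of x y] zero_iff[of y x]
    by (auto simp: d_max_def max_def)
next
  fix x y z assume "x \<in> X" "y \<in> X" "z \<in> X"
  then show "\<bar>d_max d x z\<bar> \<le> \<bar>d_max d x y\<bar> + \<bar>d_max d y z\<bar>"
    using triangle[of x y z] triangle[of z y x] nonneg[of x z] nonneg[of z x]
    by (auto simp: d_max_def)
qed simp

lemma busemann_compact_iff_sequentially:
  assumes B: "busemann_axiom X d"
  shows "d_compact X d \<longleftrightarrow>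
    (\<forall>s. range s \<subseteq> X \<longrightarrow>
      (\<exists>r x. strict_mono (r :: nat \<Rightarrow> nat) \<and> x \<in> X \<and> d_converges d (s \<circ> r) x))"
proof -
  define e where "e = (\<lambda>x y. \<bar>d_max d x y\<bar>)"
  interpret E: Metric_space X e
    unfolding e_def by (rule Metric_space_abs_d_max)
  have lower: "d x y \<le> 2 * e x y" and upper: "e x y \<le> d x y + d y x"
    if "x \<in> X" "y \<in> X" for x y
    using nonneg[of x y] nonneg[of y x] that by (auto simp: e_def d_max_def)
  have topology: "d_topology X d = E.mtopology"
    using busemann_topology_eq[OF B lower upper] E.d_topology_eq_mtopology by simp
  have limit: "limitin E.mtopology s x sequentially \<longleftrightarrow> x \<in> X \<and> d_converges d s x"
    if s: "range s \<subseteq> X" for s x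
  proof (cases "x \<in> X")
    case True
    then show ?thesis
      using s busemann_d_converges_iff[OF B lower upper s True]
      by (auto simp: E.limitin_metric_dist_null d_converges_def intro!: always_eventually)
  qed (simp add: E.limitin_metric_dist_null)
  have "limitin E.mtopology (s \<circ> r) x sequentially \<longleftrightarrow> x \<in> X \<and> d_converges d (s \<circ> r) x"
    if "range s \<subseteq> X" for s x and r :: "nat \<Rightarrow> nat"
    using that by (intro limit) auto
  then show ?thesis
    unfolding d_compact_def topology E.compact_space_sequentially by metis
qed

end

theorem proposition4p19:
  fixes X :: "'a set" and d :: "'a \<Rightarrow> 'a \<Rightarrow> real"
  assumes "asym_metric_space X d" and "busemann_axiom X d"
  shows "(d_compact X d \<longleftrightarrow> d_compact X (d_arith d)) \<and>
         (d_compact X (d_arith d) \<longleftrightarrow> d_compact X (d_max d)) \<and>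
         (d_compact X (d_max d) \<longleftrightarrow>
            (\<forall>s. range s \<subseteq> X \<longrightarrow>
               (\<exists>r x. strict_mono (r :: nat \<Rightarrow> nat) \<and> x \<in> X \<and> d_converges d (s \<circ> r) x)))"
proof -
  interpret asym_metric_space X d
    by (fact assms(1))
  have "d_topology X (d_arith d) = d_topology X d"
    using nonneg by (intro busemann_topology_eq assms(2)) (simp_all add: d_arith_def)
  moreover have "d_topology X (d_max d) = d_topology X d"
  proof (intro busemann_topology_eq assms(2))
    fix x y assume "x \<in> X" "y \<in> X"
    then show "d x y \<le> 2 * d_max d x y" "d_max d x y \<le> d x y + d y x"
      using nonneg[of x y] nonneg[of y x] by (auto simp: d_max_def)
  qed
  ultimately show ?thesis
    using busemann_compact_iff_sequentially[OF assms(2)] by (simp add: d_compact_def)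
qed

end
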